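(* Let $X=(a_1,\dots,a_N)$ be a finite list of nonzero vectors spanning the finite-dimensional vector space $V$, and let $A=S[V]$. For all $\underline\mu=(\mu_1,\dots,\mu_N)\in\mathbb C^N$ the ring $A_X(\underline\mu):=A/I_X(\underline\mu)$ has dimension (as a vector space) equal to the number $d(X)$ of bases of $V$ which can be extracted from $X$.
   Context: $V$ is an $s$-dimensional complex vector space and $A:=S[V]$ its symmetric algebra. $X=(a_1,\dots,a_N)$ is a list of nonzero vectors (repetitions allowed) spanning $V$; sublists are identified with sets of indices. A sublist $Y\subset X$ is a cocircuit if the elements of $X-Y$ do not span $V$; $\mathcal E(X)$ is the set of cocircuits. $I_X(\underline\mu)\subset S[V]$ is the ideal generated by the elements $\prod_{a_j\in Y}(a_j-\mu_j)$, $Y\in\mathcal E(X)$. $d(X)$ is the number of $s$-element index sets $\{i_1<\dots<i_s\}$ such that $a_{i_1},\dots,a_{i_s}$ is a basis of $V$. *)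

theory Defs
  imports "HOL-Algebra.Algebra" "HOL-Algebra.Algebraic_Closure_Type" "HOL-Library.Poly_Mapping"
begin

text \<open>
  A complex vector space \<open>V\<close> is a type \<open>'v\<close> together with a scalar multiplication \<open>scale\<close> such that
  \<^prop>\<open>vector_space scale\<close> holds for \<open>scale :: complex \<Rightarrow> 'v \<Rightarrow> 'v\<close>.

  The symmetric algebra \<open>S[V]\<close> is constructed without choosing a basis: it is the commutative
  complex algebra generated by symbols \<open>x\<^sub>v\<close>, one for each vector \<open>v\<close>, subject to the relations
  saying that \<open>v \<mapsto> x\<^sub>v\<close> is linear.
\<close>

type_synonym 'v free_alg = "('v \<Rightarrow>\<^sub>0 nat) \<Rightarrow>\<^sub>0 complex"

abbreviation free_ring :: "'v free_alg ring"
  where "free_ring \<equiv> ring_of_type_algebra"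

definition free_gen :: "'v \<Rightarrow> 'v free_alg"
  where "free_gen v = Poly_Mapping.single (Poly_Mapping.single v 1) 1"

definition free_const :: "complex \<Rightarrow> 'v free_alg"
  where "free_const c = Poly_Mapping.single 0 c"

definition linear_relations :: "(complex \<Rightarrow> 'v \<Rightarrow> 'v) \<Rightarrow> ('v::ab_group_add) free_alg set"
  where "linear_relations scale =
    {free_gen (v + w) - free_gen v - free_gen w | v w. True} \<union>
    {free_gen (scale c v) - free_const c * free_gen v | c v. True}"

definition linear_ideal :: "(complex \<Rightarrow> 'v \<Rightarrow> 'v) \<Rightarrow> ('v::ab_group_add) free_alg set"
  where "linear_ideal scale = Idl\<^bsub>free_ring\<^esub> (linear_relations scale)"

definition sym_alg :: "(complex \<Rightarrow> 'v \<Rightarrow> 'v) \<Rightarrow> ('v::ab_group_add) free_alg set ring"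
  where "sym_alg scale = free_ring Quot linear_ideal scale"

text \<open>The canonical maps from \<open>V\<close> and from the scalars to \<open>S[V]\<close>.\<close>

definition sym_vec :: "(complex \<Rightarrow> 'v \<Rightarrow> 'v) \<Rightarrow> 'v::ab_group_add \<Rightarrow> 'v free_alg set"
  where "sym_vec scale v = linear_ideal scale +>\<^bsub>free_ring\<^esub> free_gen v"

definition sym_const :: "(complex \<Rightarrow> 'v \<Rightarrow> 'v) \<Rightarrow> complex \<Rightarrow> ('v::ab_group_add) free_alg set"
  where "sym_const scale c = linear_ideal scale +>\<^bsub>free_ring\<^esub> free_const c"

text \<open>Sublists of \<open>Xs\<close> are sets of indices; indices start at \<open>0\<close>.\<close>

definition cocircuits :: "(complex \<Rightarrow> 'v \<Rightarrow> 'v) \<Rightarrow> ('v::ab_group_add) list \<Rightarrow> nat set set"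
  where "cocircuits scale Xs =
    {Y. Y \<subseteq> {..<length Xs} \<and> module.span scale ((!) Xs ` ({..<length Xs} - Y)) \<noteq> UNIV}"

definition I_X :: "(complex \<Rightarrow> 'v \<Rightarrow> 'v) \<Rightarrow> ('v::ab_group_add) list \<Rightarrow> complex list
    \<Rightarrow> 'v free_alg set set"
  where "I_X scale Xs mu = Idl\<^bsub>sym_alg scale\<^esub>
    {\<Otimes>\<^bsub>sym_alg scale\<^esub>j\<in>Y. (sym_vec scale (Xs ! j) \<ominus>\<^bsub>sym_alg scale\<^esub> sym_const scale (mu ! j))
      | Y. Y \<in> cocircuits scale Xs}"

definition A_X :: "(complex \<Rightarrow> 'v \<Rightarrow> 'v) \<Rightarrow> ('v::ab_group_add) list \<Rightarrow> complex list
    \<Rightarrow> 'v free_alg set set ring"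
  where "A_X scale Xs mu = sym_alg scale Quot I_X scale Xs mu"

text \<open>The copy of the complex numbers inside \<open>A_X\<close> that makes it a complex vector space.\<close>

definition A_X_scalars :: "(complex \<Rightarrow> 'v \<Rightarrow> 'v) \<Rightarrow> ('v::ab_group_add) list \<Rightarrow> complex list
    \<Rightarrow> 'v free_alg set set set"
  where "A_X_scalars scale Xs mu =
    (\<lambda>c. I_X scale Xs mu +>\<^bsub>sym_alg scale\<^esub> sym_const scale c) ` UNIV"

text \<open>
  The list \<open>Xs\<close> may contain repetitions, so a set of indices gives a basis only if \<open>Xs\<close> is moreover
  injective on it.
\<close>

definition num_bases :: "(complex \<Rightarrow> 'v \<Rightarrow> 'v) \<Rightarrow> ('v::ab_group_add) list \<Rightarrow> nat"
  where "num_bases scale Xs = card {B. B \<subseteq> {..<length Xs} \<and>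
    card B = vector_space.dim scale UNIV \<and> inj_on ((!) Xs) B \<and>
    \<not> module.dependent scale ((!) Xs ` B) \<and> module.span scale ((!) Xs ` B) = UNIV}"

lemma linear_ideal_ideal: "ideal (linear_ideal scale) free_ring"
  unfolding linear_ideal_def
  by (rule ring.genideal_ideal[OF ring_from_type_algebra])
     (simp add: ring_of_type_algebra_def)

lemma cring_sym_alg: "cring (sym_alg scale)"
  unfolding sym_alg_def
  by (rule ideal.quotient_is_cring[OF linear_ideal_ideal cring_from_type_algebra])

lemma sym_vec_closed: "sym_vec scale v \<in> carrier (sym_alg scale)"
  and sym_const_closed: "sym_const scale c \<in> carrier (sym_alg scale)"
  by (auto simp: sym_vec_def sym_const_def sym_alg_def FactRing_def A_RCOSETS_def'
      ring_of_type_algebra_def)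

lemma I_X_ideal: "ideal (I_X scale Xs mu) (sym_alg scale)"
  unfolding I_X_def
proof (rule ring.genideal_ideal[OF cring.axioms(1)[OF cring_sym_alg]], safe)
  interpret S: cring "sym_alg scale" by (rule cring_sym_alg)
  fix Y
  show "(\<Otimes>\<^bsub>sym_alg scale\<^esub>j\<in>Y. sym_vec scale (Xs ! j) \<ominus>\<^bsub>sym_alg scale\<^esub> sym_const scale (mu ! j))
      \<in> carrier (sym_alg scale)"
    by (rule S.finprod_closed) (simp add: Pi_iff sym_vec_closed sym_const_closed)
qed

lemma cring_A_X: "cring (A_X scale Xs mu)"
  unfolding A_X_def by (rule ideal.quotient_is_cring[OF I_X_ideal cring_sym_alg])

end

(*
  Reading the indices in order, multiplication by x_a - mu_a maps the quotient of the deletion X - a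
  onto the kernel of the projection to the quotient of the contraction X / a. Hence the quotient is
  spanned by explicit products p_B of factors x_j - mu_j, one for every basis B, and this holds
  over any ring of parameters.

  For linear independence, deform mu_j to mu_j + t^(j+1). For all but finitely many t each basis B
  gives a point where exactly the hyperplanes indexed by B vanish; the ideal vanishes at these points,
  and evaluating the p_B there gives a triangular matrix with nonzero diagonal. A relation at t = 0
  lifts to the relation with coefficients c_B - t e_B(t) over the polynomial ring in t. It is trivial
  for generic t, so these polynomials are zero, and so are their values c_B at t = 0.
*)
theory Submission
  imports Defs
begin

section \<open>The symmetric algebra: ideals, evaluation, induction\<close>

text \<open>\<open>idl.span G\<close> is the ideal generated by \<open>G\<close>.\<close>

interpretation idl: Modules.module "(*) :: 'r::comm_ring_1 \<Rightarrow> 'r \<Rightarrow> 'r"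
  by unfold_locales (auto simp: algebra_simps)

text \<open>For multiplication this rule is associativity with the brackets moved to the left,
  against the usual normal form.\<close>

declare idl.scale_scale [simp del]

text \<open>Used to specialise the deformation parameter inside an ideal.\<close>

lemma idl_span_hom:
  fixes h :: "'r::comm_ring_1 \<Rightarrow> 's::comm_ring_1"
  assumes "h 0 = 0" "\<And>x y. h (x + y) = h x + h y" "\<And>x y. h (x * y) = h x * h y"
    and "\<And>g. g \<in> G \<Longrightarrow> h g \<in> idl.span H" and "f \<in> idl.span G"
  shows "h f \<in> idl.span H"
  using assms(5)
  by (induction rule: idl.span_induct_alt)
    (auto simp: assms(1-3) intro!: idl.span_zero idl.span_add idl.span_scale assms(4))

text \<open>Surjectivity lifts the coefficients of a combination of \<open>H\<close>, and the
  inclusion lifts its generators. This later extends a relation at t = 0 to the deformed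
  family.\<close>

lemma idl_span_lift:
  fixes h :: "'r::comm_ring_1 \<Rightarrow> 's::comm_ring_1"
  assumes "h 0 = 0" "\<And>x y. h (x + y) = h x + h y" "\<And>x y. h (x * y) = h x * h y" "surj h"
    and "H \<subseteq> h ` G" and "f \<in> idl.span H"
  shows "\<exists>g\<in>idl.span G. h g = f"
  using assms(6)
proof (induction rule: idl.span_induct_alt)
  case base
  then show ?case using assms(1) idl.span_zero by blast
next
  case (step r x y)
  then obtain g where g: "g \<in> idl.span G" "h g = y" by blast
  obtain s where s: "h s = r" using \<open>surj h\<close> by (metis surjD)
  obtain x' where x': "x' \<in> G" "h x' = x" using step assms(5) by blast
  have "s * x' + g \<in> idl.span G" 
    using g x' by (simp add: idl.span_add idl.span_scale idl.span_base)
  then show ?case using g s x' assms(2,3) by metis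
qed

lemma poly_mapping_eq_sum_single:
  "f = (\<Sum>m\<in>Poly_Mapping.keys f. Poly_Mapping.single m (Poly_Mapping.lookup f m))"
  by (rule poly_mapping_eqI) (auto simp: lookup_sum lookup_single when_def in_keys_iff sum.delta)

section \<open>Evaluation of the free algebra at complex values of its generators\<close>

definition monom_val :: "('v \<Rightarrow> complex) \<Rightarrow> ('v \<Rightarrow>\<^sub>0 nat) \<Rightarrow> complex"
  where "monom_val \<phi> m = (\<Prod>v\<in>Poly_Mapping.keys m. \<phi> v ^ Poly_Mapping.lookup m v)"

text \<open>The algebra homomorphism extending \<open>\<phi>\<close>. It kills the linear relations
  exactly when \<open>\<phi>\<close> is linear, and is then evaluation at a point of the dual
  space.\<close>

definition eval_free :: "('v \<Rightarrow> complex) \<Rightarrow> 'v free_alg \<Rightarrow> complex"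
  where "eval_free \<phi> f = (\<Sum>m\<in>Poly_Mapping.keys f. Poly_Mapping.lookup f m * monom_val \<phi> m)"

lemma monom_val_superset:
  "finite S \<Longrightarrow> Poly_Mapping.keys m \<subseteq> S \<Longrightarrow> monom_val \<phi> m = (\<Prod>v\<in>S. \<phi> v ^ Poly_Mapping.lookup m v)"
  unfolding monom_val_def by (rule prod.mono_neutral_left) (auto simp: in_keys_iff)

lemma monom_val_add: "monom_val \<phi> (m + n) = monom_val \<phi> m * monom_val \<phi> n"
proof -
  let ?S = "Poly_Mapping.keys m \<union> Poly_Mapping.keys n"
  have "monom_val \<phi> (m + n) = (\<Prod>v\<in>?S. \<phi> v ^ Poly_Mapping.lookup (m + n) v)"
    by (rule monom_val_superset) (simp_all add: Poly_Mapping.keys_add)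
  also have "\<dots> = (\<Prod>v\<in>?S. \<phi> v ^ Poly_Mapping.lookup m v) * (\<Prod>v\<in>?S. \<phi> v ^ Poly_Mapping.lookup n v)"
    by (simp add: lookup_add power_add prod.distrib)
  also have "\<dots> = monom_val \<phi> m * monom_val \<phi> n"
    by (simp add: monom_val_superset[of ?S m] monom_val_superset[of ?S n])
  finally show ?thesis .
qed

lemma eval_free_superset:
  "finite S \<Longrightarrow> Poly_Mapping.keys f \<subseteq> S \<Longrightarrow>
    eval_free \<phi> f = (\<Sum>m\<in>S. Poly_Mapping.lookup f m * monom_val \<phi> m)"
  unfolding eval_free_def by (rule sum.mono_neutral_left) (auto simp: in_keys_iff)

lemma eval_free_zero [simp]: "eval_free \<phi> 0 = 0"
  by (simp add: eval_free_def)

lemma eval_free_single: "eval_free \<phi> (Poly_Mapping.single m c) = c * monom_val \<phi> m"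
  by (simp add: eval_free_def)

lemma eval_free_add: "eval_free \<phi> (f + g) = eval_free \<phi> f + eval_free \<phi> g"
proof -
  let ?S = "Poly_Mapping.keys f \<union> Poly_Mapping.keys g"
  have "eval_free \<phi> (f + g) = (\<Sum>v\<in>?S. Poly_Mapping.lookup (f + g) v * monom_val \<phi> v)"
    by (rule eval_free_superset) (simp_all add: Poly_Mapping.keys_add)
  then show ?thesis
    by (simp add: eval_free_superset[of ?S f] eval_free_superset[of ?S g] lookup_add
        distrib_right sum.distrib)
qed

lemma eval_free_sum: "eval_free \<phi> (sum f S) = (\<Sum>i\<in>S. eval_free \<phi> (f i))"
  by (induction S rule: infinite_finite_induct) (auto simp: eval_free_add)

lemma eval_free_mult: "eval_free \<phi> (f * g) = eval_free \<phi> f * eval_free \<phi> g"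
proof -
  have "f * g = (\<Sum>m\<in>Poly_Mapping.keys f. Poly_Mapping.single m (Poly_Mapping.lookup f m)) *
      (\<Sum>n\<in>Poly_Mapping.keys g. Poly_Mapping.single n (Poly_Mapping.lookup g n))"
    by (rule arg_cong2[where f = "(*)"]; rule poly_mapping_eq_sum_single)
  then have "f * g = (\<Sum>m\<in>Poly_Mapping.keys f. \<Sum>n\<in>Poly_Mapping.keys g.
    Poly_Mapping.single (m + n) (Poly_Mapping.lookup f m * Poly_Mapping.lookup g n))"
    by (simp only: sum_product mult_single)
  then have "eval_free \<phi> (f * g) = (\<Sum>m\<in>Poly_Mapping.keys f. \<Sum>n\<in>Poly_Mapping.keys g.
    (Poly_Mapping.lookup f m * monom_val \<phi> m) * (Poly_Mapping.lookup g n * monom_val \<phi> n))"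
    by (simp only: eval_free_sum eval_free_single monom_val_add mult.assoc mult.left_commute)
  then show ?thesis by (simp only: eval_free_def[of _ f] eval_free_def[of _ g] sum_product)
qed

lemma eval_free_diff: "eval_free \<phi> (f - g) = eval_free \<phi> f - eval_free \<phi> g"
  using eval_free_add[of \<phi> "f - g" g] by simp

lemma eval_free_gen [simp]: "eval_free \<phi> (free_gen v) = \<phi> v"
  by (simp add: free_gen_def eval_free_single monom_val_def)

lemma eval_free_const [simp]: "eval_free \<phi> (free_const c) = c"
  by (simp add: free_const_def eval_free_single monom_val_def)

lemma eval_free_prod: "eval_free \<phi> (prod f S) = (\<Prod>i\<in>S. eval_free \<phi> (f i))"
  using eval_free_const[of \<phi> 1]
  by (induction S rule: infinite_finite_induct) (auto simp: eval_free_mult free_const_def)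

lemma free_const_hom:
  "free_const 0 = 0" "free_const 1 = 1" "free_const (a + b) = free_const a + free_const b"
  "free_const (a - b) = free_const a - free_const b" "free_const (a * b) = free_const a * free_const b"
  "free_const (- a) = - free_const a"
  by (simp_all add: free_const_def single_add single_diff mult_single single_uminus)

text \<open>Every monomial arises from 1 by multiplying by one generator at a time, so an argument
  modulo an ideal only has to treat scalars and single vectors.\<close>

lemma free_alg_induct [case_names zero add const_mult one gen_mult]:
  fixes f :: "'v free_alg"
  assumes zero: "P 0" and add: "\<And>f g. P f \<Longrightarrow> P g \<Longrightarrow> P (f + g)"
    and const_mult: "\<And>c f. P f \<Longrightarrow> P (free_const c * f)"
    and one: "P 1" and gen_mult: "\<And>v f. P f \<Longrightarrow> P (free_gen v * f)"
  shows "P f"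
proof -
  have pow: "P (Poly_Mapping.single (Poly_Mapping.single v k) 1 * g)" if "P g" for v k g
    using that
  proof (induction k)
    case (Suc k)
    have "Poly_Mapping.single (Poly_Mapping.single v (Suc k)) 1 * g
        = free_gen v * (Poly_Mapping.single (Poly_Mapping.single v k) 1 * g)"
      by (simp add: free_gen_def mult_single mult.assoc[symmetric] single_add[symmetric])
    then show ?case using Suc gen_mult by metis
  qed simp
  have "P (Poly_Mapping.single (\<Sum>v\<in>S. Poly_Mapping.single v (k v)) 1)" for S and k :: "'v \<Rightarrow> nat"
  proof (induction S rule: infinite_finite_induct)
    case (insert v S)
    have "Poly_Mapping.single (\<Sum>v\<in>insert v S. Poly_Mapping.single v (k v)) (1::complex)
        = Poly_Mapping.single (Poly_Mapping.single v (k v)) 1 *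
          Poly_Mapping.single (\<Sum>v\<in>S. Poly_Mapping.single v (k v)) 1"
      using insert by (simp add: mult_single)
    then show ?case using pow insert by metis
  qed (simp_all add: one)
  \<comment> \<open>The exponents \<open>lookup m\<close> over the support \<open>keys m\<close>
    recover the monomial \<open>m\<close> itself.\<close>
  from this[of "Poly_Mapping.lookup m" "Poly_Mapping.keys m" for m]
  have "P (Poly_Mapping.single m 1)" for m :: "'v \<Rightarrow>\<^sub>0 nat"
    unfolding poly_mapping_eq_sum_single[symmetric] .
  then have "P (Poly_Mapping.single m c)" for m c
    using const_mult[of "Poly_Mapping.single m 1" c] by (simp add: free_const_def mult_single)
  then have "P (\<Sum>m\<in>S. Poly_Mapping.single m (Poly_Mapping.lookup f m))" for S
    by (induction S rule: infinite_finite_induct) (auto simp: zero add)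
  from this[of "Poly_Mapping.keys f"] show ?thesis
    unfolding poly_mapping_eq_sum_single[symmetric] .
qed

section \<open>Spanning by deletion and contraction\<close>

locale vector_list = vector_space scale for scale :: "complex \<Rightarrow> 'v::ab_group_add \<Rightarrow> 'v" +
  fixes Xs :: "'v list"
begin

definition indep :: "nat set \<Rightarrow> bool"
  where "indep C \<longleftrightarrow> C \<subseteq> {..<length Xs} \<and> inj_on ((!) Xs) C \<and> independent ((!) Xs ` C)"

definition bases :: "nat set set"
  where "bases = {B. indep B \<and> span ((!) Xs ` B) = UNIV}"

text \<open>Read the indices in increasing order, contracting those in \<open>B\<close> and deleting the others: \<open>j\<close> is
  passive if \<open>Xs ! j\<close> is nonzero in the current contraction when it is deleted. Then
  \<^term>\<open>prod y (ext_passive B)\<close> is the basis element of the quotient that belongs to \<open>B\<close>.\<close>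

definition ext_passive :: "nat set \<Rightarrow> nat set"
  where "ext_passive B = {j \<in> {..<length Xs} - B. Xs ! j \<notin> span ((!) Xs ` (B \<inter> {..<j}))}"

lemma finite_bases: "finite bases"
  by (rule finite_subset[of _ "Pow {..<length Xs}"]) (auto simp: bases_def indep_def)

lemma indep_mono: "indep B \<Longrightarrow> C \<subseteq> B \<Longrightarrow> indep C"
  unfolding indep_def by (meson image_mono independent_mono inj_on_subset order_trans)

text \<open>A repeated vector lies in the span of its first copy, so avoiding the span of
  \<open>C\<close> also keeps the indexing injective.\<close>

lemma indep_insert:
  assumes "j \<notin> C"
  shows "indep (insert j C) \<longleftrightarrow> indep C \<and> j < length Xs \<and> Xs ! j \<notin> span ((!) Xs ` C)"
  using assms unfolding indep_def by (auto simp: independent_insert inj_on_insert span_base)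

text \<open>Injectivity on \<open>B\<close> makes the number of indices equal to the number of basis
  vectors, which is the dimension.\<close>

lemma num_bases_eq: "num_bases scale Xs = card bases"
proof -
  have "card B = dim UNIV" if "B \<in> bases" for B
    using that dim_eq_card[of "(!) Xs ` B" UNIV] unfolding bases_def indep_def
    by (simp add: card_image)
  then show ?thesis
    unfolding num_bases_def bases_def indep_def by (metis (mono_tags, lifting) mem_Collect_eq)
qed

text \<open>The generators of the ideal obtained from deleting the indices below \<open>k\<close> outside \<open>C\<close> and
  contracting those in \<open>C\<close>.\<close>

definition minor_gens :: "('r::comm_ring_1) set \<Rightarrow> (nat \<Rightarrow> 'r) \<Rightarrow> nat \<Rightarrow> nat set \<Rightarrow> 'r set"
  where "minor_gens L y k C = L \<union> y ` C \<union>
    {prod y Y | Y. Y \<subseteq> {k..<length Xs} \<and> span ((!) Xs ` (({k..<length Xs} - Y) \<union> C)) \<noteq> UNIV}"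

text \<open>Downward induction over minors: indices below \<open>k\<close> are contracted if they
  lie in \<open>C\<close> and deleted otherwise. It starts with every index decided, where
  \<open>base\<close> reduces the quotient to coefficients in \<open>K\<close>; each step undoes the
  decision on one index.\<close>

lemma minor_spanning:
  fixes y :: "nat \<Rightarrow> 'r::comm_ring_1"
  assumes base: "\<And>B f. B \<in> bases \<Longrightarrow> \<exists>c\<in>K. f - c \<in> idl.span (L \<union> y ` B)"
    and "k \<le> length Xs" and "C \<subseteq> {..<k}" and "indep C"
  shows "\<exists>c. c ` bases \<subseteq> K \<and>
    f - (\<Sum>B | B \<in> bases \<and> B \<inter> {..<k} = C. c B * (\<Prod>j\<in>ext_passive B \<inter> {k..}. y j))
      \<in> idl.span (minor_gens L y k C)"
  using assms(2-)
proof (induction k arbitrary: C f rule: inc_induct)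
  case base
  let ?N = "length Xs"
  have sub: "B \<subseteq> {..<?N}" if "B \<in> bases" for B using that by (auto simp: bases_def indep_def)
  have eqC: "B \<inter> {..<?N} = C \<longleftrightarrow> B = C" if "B \<in> bases" for B using sub[OF that] by blast
  show ?case
  \<comment> \<open>With all indices decided, the only candidate for a cocircuit is the empty set.
    It is none if \<open>C\<close> is a basis; otherwise its product 1 makes the ideal the whole
    ring.\<close>
  proof (cases "C \<in> bases")
    case True
    obtain c where c: "c \<in> K" "f - c \<in> idl.span (L \<union> y ` C)"
      using assms(1)[OF True] by blast
    have s: "{B. B \<in> bases \<and> B \<inter> {..<?N} = C} = {C}" using True eqC by auto
    have p: "ext_passive C \<inter> {?N..} = {}" by (auto simp: ext_passive_def)
    have "idl.span (L \<union> y ` C) \<subseteq> idl.span (minor_gens L y ?N C)"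
      by (rule idl.span_mono) (auto simp: minor_gens_def)
    then show ?thesis using c by (intro exI[of _ "\<lambda>_. c"]) (auto simp: s p)
  next
    case False
    then have "prod y {} \<in> minor_gens L y ?N C"
      unfolding minor_gens_def using base by (auto simp: bases_def)
    then have "1 \<in> idl.span (minor_gens L y ?N C)" by (simp add: idl.span_base)
    then have all: "g \<in> idl.span (minor_gens L y ?N C)" for g
      using idl.span_scale[of 1 _ g] by simp
    \<comment> \<open>Coefficients must lie in \<open>K\<close> even for bases outside the sum; any
      choice works here.\<close>
    have "\<forall>B\<in>bases. \<exists>c. c \<in> K" using assms(1) by blast
    from bchoice[OF this] obtain c where "\<forall>B\<in>bases. c B \<in> K" ..
    then show ?thesis using all by (intro exI[of _ c]) auto
  qed
next
  case (step k)
  let ?N = "length Xs"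
  have C: "C \<subseteq> {..<Suc k}" "k \<notin> C" "C \<subseteq> {..<k}" using step.prems by auto
  have ivl: "{k..<?N} = insert k {Suc k..<?N}" using step.hyps by auto
  note del = step.IH[OF C(1) step.prems(2)]
  show ?case
  \<comment> \<open>An \<open>Xs ! k\<close> in the span of \<open>C\<close> is a loop of the minor:
    no basis of the minor contains \<open>k\<close>, and \<open>k\<close> is never passive, so the
    expansion for the deletion carries over unchanged.\<close>
  proof (cases "Xs ! k \<in> span ((!) Xs ` C)")
    case True
    have nk: "k \<notin> B" if "B \<in> bases" "B \<inter> {..<k} = C" for B
    proof
      assume "k \<in> B"
      then have "indep (insert k C)" using that by (auto simp: bases_def intro: indep_mono)
      then show False using True C(2) by (simp add: indep_insert)
    qed
    have npas: "k \<notin> ext_passive B" if "B \<inter> {..<k} = C" for B using that True by (auto simp: ext_passive_def)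
    have S: "{B. B \<in> bases \<and> B \<inter> {..<Suc k} = C} = {B. B \<in> bases \<and> B \<inter> {..<k} = C}"
      using nk C(2) by (auto simp: lessThan_Suc)
    have P: "ext_passive B \<inter> {Suc k..} = ext_passive B \<inter> {k..}" if "B \<inter> {..<k} = C" for B
      using npas[OF that] by (auto simp: Suc_le_eq le_less)
    \<comment> \<open>A loop adds nothing to a span taken together with \<open>C\<close>, so every
      cocircuit of the deletion stays a cocircuit.\<close>
    have "minor_gens L y (Suc k) C \<subseteq> minor_gens L y k C"
    proof -
      have "\<exists>Y'. prod y Y = prod y Y' \<and> Y' \<subseteq> {k..<?N} \<and> span ((!) Xs ` (({k..<?N} - Y') \<union> C)) \<noteq> UNIV"
        if Y: "Y \<subseteq> {Suc k..<?N}" "span ((!) Xs ` (({Suc k..<?N} - Y) \<union> C)) \<noteq> UNIV" for Y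
      proof (intro exI conjI)
        let ?T = "(!) Xs ` (({Suc k..<?N} - Y) \<union> C)"
        have "Xs ! k \<in> span ?T" using True span_mono[of "(!) Xs ` C" ?T] by auto
        then have "span (insert (Xs ! k) ?T) = span ?T" by (rule span_redundant)
        moreover have "(!) Xs ` (({k..<?N} - Y) \<union> C) = insert (Xs ! k) ?T"
          using Y(1) unfolding ivl by auto
        ultimately show "span ((!) Xs ` (({k..<?N} - Y) \<union> C)) \<noteq> UNIV" using Y(2) by simp
      qed (use Y in \<open>auto simp: ivl\<close>)
      then show ?thesis unfolding minor_gens_def by (intro Un_mono order_refl) (simp add: subset_iff, metis)
    qed
    then have "idl.span (minor_gens L y (Suc k) C) \<subseteq> idl.span (minor_gens L y k C)"
      by (rule idl.span_mono)
    moreover obtain c where "c ` bases \<subseteq> K"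
      "f - (\<Sum>B | B \<in> bases \<and> B \<inter> {..<Suc k} = C. c B * (\<Prod>j\<in>ext_passive B \<inter> {Suc k..}. y j))
        \<in> idl.span (minor_gens L y (Suc k) C)" using del by blast
    moreover have "(\<Sum>B | B \<in> bases \<and> B \<inter> {..<Suc k} = C. c B * (\<Prod>j\<in>ext_passive B \<inter> {Suc k..}. y j))
      = (\<Sum>B | B \<in> bases \<and> B \<inter> {..<k} = C. c B * (\<Prod>j\<in>ext_passive B \<inter> {k..}. y j))"
      unfolding S by (intro sum.cong) (auto simp: P)
    ultimately show ?thesis by auto
  next
    case False
    \<comment> \<open>First \<open>f\<close> is expanded modulo the contraction ideal, using the
      bases that contain \<open>k\<close>. The remainder is a multiple \<open>g * y k\<close> modulo
      the other generators, and \<open>g\<close> is then expanded in the deletion.\<close>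
    let ?C = "insert k C"
    have "indep ?C" using False step.prems step.hyps C(2) by (simp add: indep_insert)
    then obtain c where c: "c ` bases \<subseteq> K"
      and c_mem: "f - (\<Sum>B | B \<in> bases \<and> B \<inter> {..<Suc k} = ?C. c B * (\<Prod>j\<in>ext_passive B \<inter> {Suc k..}. y j))
        \<in> idl.span (minor_gens L y (Suc k) ?C)" (is "f - ?s \<in> _")
      using step.IH[of ?C f] C(1) by (auto simp: lessThan_Suc)
    \<comment> \<open>Setting \<open>y k\<close> apart exposes its coefficient \<open>g\<close>; the
      other generators of the contraction already belong to the current minor.\<close>
    define M where "M = minor_gens L y (Suc k) ?C - {y k}"
    have "minor_gens L y (Suc k) ?C \<subseteq> insert (y k) M" by (auto simp: M_def)
    then have "f - ?s \<in> idl.span (insert (y k) M)" using c_mem idl.span_mono by blast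
    then obtain g where g: "f - ?s - g * y k \<in> idl.span M"
      using idl.span_breakdown_eq by blast
    obtain d where d: "d ` bases \<subseteq> K"
      and d_mem: "g - (\<Sum>B | B \<in> bases \<and> B \<inter> {..<Suc k} = C. d B * (\<Prod>j\<in>ext_passive B \<inter> {Suc k..}. y j))
        \<in> idl.span (minor_gens L y (Suc k) C)" (is "g - ?r \<in> _")
      using del by blast
    have M: "M \<subseteq> minor_gens L y k C"
    proof -
      have "m \<in> minor_gens L y k C" if m: "m \<in> minor_gens L y (Suc k) ?C" "m \<noteq> y k" for m
      proof (cases "m \<in> L \<union> y ` C")
        case True
        then show ?thesis by (simp add: minor_gens_def)
      next
        case False
        then obtain Y where Y: "m = prod y Y" "Y \<subseteq> {Suc k..<?N}"
            "span ((!) Xs ` (({Suc k..<?N} - Y) \<union> ?C)) \<noteq> UNIV"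
          using m by (auto simp: minor_gens_def)
        have "({Suc k..<?N} - Y) \<union> ?C = ({k..<?N} - Y) \<union> C" using Y(2) unfolding ivl by auto
        moreover have "Y \<subseteq> {k..<?N}" using Y(2) unfolding ivl by auto
        ultimately show ?thesis using Y(1,3) unfolding minor_gens_def by auto
      qed
      then show ?thesis unfolding M_def by blast
    qed
    \<comment> \<open>Adding \<open>k\<close> to a cocircuit of the deletion gives a cocircuit of
      the current minor. Hence multiplication by \<open>y k\<close> carries the deletion ideal into
      the current one.\<close>
    have yk: "y k * m \<in> idl.span (minor_gens L y k C)" if "m \<in> minor_gens L y (Suc k) C" for m
    proof (cases "m \<in> L \<union> y ` C")
      case True
      then show ?thesis by (intro idl.span_scale idl.span_base) (auto simp: minor_gens_def)
    next
      case False
      then obtain Y where Y: "m = prod y Y" "Y \<subseteq> {Suc k..<?N}"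
          "span ((!) Xs ` (({Suc k..<?N} - Y) \<union> C)) \<noteq> UNIV"
        using \<open>m \<in> _\<close> by (auto simp: minor_gens_def)
      have "k \<notin> Y" "finite Y" using Y(2) finite_subset by auto
      then have "y k * m = prod y (insert k Y)" using Y(1) by simp
      moreover have "{Suc k..<?N} - Y = {k..<?N} - insert k Y" unfolding ivl by auto
      ultimately have "y k * m \<in> minor_gens L y k C"
        using Y ivl unfolding minor_gens_def by (auto intro!: exI[of _ "insert k Y"])
      then show ?thesis by (rule idl.span_base)
    qed
    have ideal_yk: "y k * h \<in> idl.span (minor_gens L y k C)"
      if "h \<in> idl.span (minor_gens L y (Suc k) C)" for h
      using that
    proof (induction rule: idl.span_induct_alt)
      case base
      then show ?case by (simp add: idl.span_zero)
    next
      case (step a m h)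
      have "y k * (a * m + h) = a * (y k * m) + y k * h" by (simp add: algebra_simps)
      then show ?case using idl.span_add[OF idl.span_scale[OF yk[OF step(1)]] step(2)] by metis
    qed
    \<comment> \<open>Bases containing \<open>k\<close> take their coefficient from the contraction,
      the others from the deletion.\<close>
    define e where "e B = (if k \<in> B then c B else d B)" for B
    let ?S = "{B. B \<in> bases \<and> B \<inter> {..<k} = C}"
    let ?Sin = "{B. B \<in> bases \<and> B \<inter> {..<Suc k} = ?C}" and ?Sout = "{B. B \<in> bases \<and> B \<inter> {..<Suc k} = C}"
    have "B \<inter> {..<Suc k} = ?C \<longleftrightarrow> B \<inter> {..<k} = C \<and> k \<in> B"
      "B \<inter> {..<Suc k} = C \<longleftrightarrow> B \<inter> {..<k} = C \<and> k \<notin> B" for B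
      using C(2) insert_ident[of k "B \<inter> {..<k}" C] by (auto simp: lessThan_Suc)
    then have S_eq: "?Sin = {B \<in> ?S. k \<in> B}" "?Sout = {B \<in> ?S. k \<notin> B}" by simp_all
    have T: "T = {B \<in> T. k \<in> B} \<union> {B \<in> T. k \<notin> B}"
      "{B \<in> T. k \<in> B} \<inter> {B \<in> T. k \<notin> B} = {}" for T :: "nat set set" by auto
    have split: "?S = ?Sin \<union> ?Sout" "?Sin \<inter> ?Sout = {}" unfolding S_eq by (rule T)+
    have fin: "finite ?Sin" "finite ?Sout" using finite_bases by auto
    have 1: "(\<Sum>B\<in>?Sin. e B * (\<Prod>j\<in>ext_passive B \<inter> {k..}. y j)) = ?s"
    proof (intro sum.cong refl)
      fix B assume "B \<in> ?Sin"
      then have "k \<in> B" by auto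
      then have "ext_passive B \<inter> {k..} = ext_passive B \<inter> {Suc k..}" "e B = c B"
        by (auto simp: ext_passive_def e_def Suc_le_eq le_less)
      then show "e B * (\<Prod>j\<in>ext_passive B \<inter> {k..}. y j) = c B * (\<Prod>j\<in>ext_passive B \<inter> {Suc k..}. y j)" by simp
    qed
    \<comment> \<open>Here \<open>k\<close> is passive, because \<open>Xs ! k\<close> is outside the
      span of \<open>C\<close>; this supplies the factor \<open>y k\<close>.\<close>
    have 2: "(\<Sum>B\<in>?Sout. e B * (\<Prod>j\<in>ext_passive B \<inter> {k..}. y j)) = y k * ?r"
      unfolding sum_distrib_left
    proof (intro sum.cong refl)
      fix B assume B: "B \<in> ?Sout"
      then have "k \<notin> B" "B \<inter> {..<k} = C" using C by (auto simp: lessThan_Suc)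
      then have "k \<in> ext_passive B" "e B = d B"
        using False step.hyps by (auto simp: ext_passive_def e_def)
      then have "ext_passive B \<inter> {k..} = insert k (ext_passive B \<inter> {Suc k..})"
        by (auto simp: Suc_le_eq le_less)
      moreover have "finite (ext_passive B \<inter> {Suc k..})" by (simp add: ext_passive_def)
      ultimately show "e B * (\<Prod>j\<in>ext_passive B \<inter> {k..}. y j) = y k * (d B * (\<Prod>j\<in>ext_passive B \<inter> {Suc k..}. y j))"
        using \<open>e B = d B\<close> by (simp add: mult_ac)
    qed
    have "f - (\<Sum>B\<in>?S. e B * (\<Prod>j\<in>ext_passive B \<inter> {k..}. y j)) = (f - ?s - g * y k) + y k * (g - ?r)"
      unfolding split(1) sum.union_disjoint[OF fin split(2)] 1 2 by (simp add: algebra_simps)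
    also have "\<dots> \<in> idl.span (minor_gens L y k C)"
      using g M ideal_yk[OF d_mem] idl.span_mono by (blast intro: idl.span_add)
    finally show ?thesis using c d by (intro exI[of _ e]) (auto simp: e_def)
  qed
qed

lemma cocircuits_eq:
  "cocircuits scale Xs = {Y. Y \<subseteq> {..<length Xs} \<and> span ((!) Xs ` ({..<length Xs} - Y)) \<noteq> UNIV}"
  by (simp add: cocircuits_def)

text \<open>The stage \<open>k = 0\<close> with \<open>C\<close> empty, where nothing is decided
  yet. The ring and \<open>K\<close> stay arbitrary so that coefficients may depend polynomially on
  t.\<close>

lemma spanning:
  fixes y :: "nat \<Rightarrow> 'r::comm_ring_1"
  assumes "\<And>B f. B \<in> bases \<Longrightarrow> \<exists>c\<in>K. f - c \<in> idl.span (L \<union> y ` B)"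
  obtains c where "c ` bases \<subseteq> K"
    "f - (\<Sum>B\<in>bases. c B * prod y (ext_passive B)) \<in> idl.span (L \<union> prod y ` cocircuits scale Xs)"
proof -
  have "indep {}" by (simp add: indep_def dependent_def)
  from minor_spanning[of K L y 0 "{}" f, OF assms _ _ this] obtain c where c: "c ` bases \<subseteq> K"
    "f - (\<Sum>B\<in>bases. c B * prod y (ext_passive B)) \<in> idl.span (minor_gens L y 0 {})"
    by (auto simp: atLeast_0)
  moreover have "minor_gens L y 0 {} = L \<union> prod y ` cocircuits scale Xs"
    by (auto simp: minor_gens_def cocircuits_eq atLeast0LessThan)
  ultimately show thesis using that by simp
qed

end

section \<open>Generic deformation\<close>

abbreviation poly_const :: "complex poly \<Rightarrow> 'v free_alg poly"
  where "poly_const \<equiv> map_poly free_const"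

lemma poly_const_hom:
  "poly_const 0 = 0" "poly_const 1 = 1" "poly_const (p + q) = poly_const p + poly_const q"
  "poly_const (smult c p) = smult (free_const c) (poly_const p)"
  "poly_const (- p) = - poly_const p"
  "poly_const (pCons c p) = pCons (free_const c) (poly_const p)"
  by (rule poly_eqI; auto simp: coeff_map_poly free_const_hom coeff_pCons split: nat.splits)+

lemma poly_poly_const: "poly (poly_const p) (free_const t) = free_const (poly p t)"
  by (induction p) (simp_all add: poly_const_hom free_const_hom)

text \<open>Horner's scheme in t reduces the claim to constant polynomials, which
  \<open>free_alg_induct\<close> covers.\<close>

lemma free_poly_induct [case_names add const_mult t_mult one gen_mult]:
  fixes f :: "'v free_alg poly"
  assumes add: "\<And>f g. P f \<Longrightarrow> P g \<Longrightarrow> P (f + g)"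
    and const_mult: "\<And>c f. P f \<Longrightarrow> P (smult (free_const c) f)"
    and t_mult: "\<And>f. P f \<Longrightarrow> P (pCons 0 f)"
    and one: "P 1" and gen_mult: "\<And>v f. P f \<Longrightarrow> P ([:free_gen v:] * f)"
  shows "P f"
proof -
  have zero: "P 0" using const_mult[OF one, of 0] by (simp add: free_const_hom)
  have base: "P [:a:]" for a
  proof (induction a rule: free_alg_induct)
    case zero
    show ?case using \<open>P 0\<close> by simp
  next
    case (add f g)
    then show ?case using assms(1)[of "[:f:]" "[:g:]"] by simp
  next
    case (const_mult c f)
    then show ?case using assms(2)[of "[:f:]" c] by simp
  next
    case one
    show ?case using \<open>P 1\<close> by (simp add: one_pCons)
  next
    case (gen_mult v f)
    then show ?case using assms(5)[of "[:f:]" v] by (simp add: mult.commute)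
  qed
  show ?thesis
  proof (induction f)
    case 0
    show ?case by (rule zero)
  next
    case (pCons a p)
    then show ?case using add[OF base[of a] t_mult[of p]] by simp
  qed
qed

text \<open>Lexicographic order: at the first index where the two sets differ, the larger set is the
  one containing it.\<close>

definition lex_less :: "nat set \<Rightarrow> nat set \<Rightarrow> bool"
  where "lex_less A B \<longleftrightarrow> (\<exists>j\<in>B - A. A \<inter> {..<j} = B \<inter> {..<j})"

lemma lex_less_total: "A \<noteq> B \<Longrightarrow> lex_less A B \<or> lex_less B A"
proof -
  assume "A \<noteq> B"
  then have ex: "\<exists>j. (j \<in> A) \<noteq> (j \<in> B)" by blast
  define j where "j = (LEAST j. (j \<in> A) \<noteq> (j \<in> B))"
  have "(j \<in> A) \<noteq> (j \<in> B)" unfolding j_def by (rule LeastI_ex[OF ex])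
  moreover have "A \<inter> {..<j} = B \<inter> {..<j}" unfolding j_def using not_less_Least by blast
  ultimately show ?thesis unfolding lex_less_def by blast
qed

lemma lex_less_trans:
  assumes "lex_less A B" "lex_less B C" shows "lex_less A C"
proof -
  obtain i where i: "i \<in> B - A" "A \<inter> {..<i} = B \<inter> {..<i}" using assms(1) by (auto simp: lex_less_def)
  obtain j where j: "j \<in> C - B" "B \<inter> {..<j} = C \<inter> {..<j}" using assms(2) by (auto simp: lex_less_def)
  have i': "k \<in> A \<longleftrightarrow> k \<in> B" if "k < i" for k using i(2) that by blast
  have j': "k \<in> B \<longleftrightarrow> k \<in> C" if "k < j" for k using j(2) that by blast
  \<comment> \<open>The smaller index is the first difference of \<open>A\<close> and
    \<open>C\<close>; \<open>i = j\<close> is impossible since \<open>i\<close> lies in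
    \<open>B\<close> and \<open>j\<close> does not.\<close>
  have "min i j \<in> C - A"
    using i(1) j(1) i'[of j] j'[of i] by (cases i j rule: linorder_cases) (auto simp: min_def)
  moreover have "A \<inter> {..<min i j} = C \<inter> {..<min i j}" using i' j' by auto
  ultimately show ?thesis unfolding lex_less_def by blast
qed

lemma lex_less_asym: "lex_less A B \<Longrightarrow> \<not> lex_less B A"
  using lex_less_trans[of A B A] by (auto simp: lex_less_def)

section \<open>The ideal in the free algebra, its deformation, and evaluation at vertices\<close>

context vector_list
begin

text \<open>Keeping the linear relations among the generators gives the preimage of
  \<open>I_X\<close> in the free algebra when \<open>m\<close> reads off \<open>mu\<close>, so no
  cosets are needed until the end.\<close>

definition ideal_gens :: "(nat \<Rightarrow> complex) \<Rightarrow> 'v free_alg set"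
  where "ideal_gens m = linear_relations scale \<union>
    prod (\<lambda>j. free_gen (Xs ! j) - free_const (m j)) ` cocircuits scale Xs"

text \<open>The ideal of the deformed arrangement over the polynomial ring in the deformation parameter.\<close>

definition family_gens :: "(nat \<Rightarrow> complex poly) \<Rightarrow> 'v free_alg poly set"
  where "family_gens M = (\<lambda>r. [:r:]) ` linear_relations scale \<union>
    prod (\<lambda>j. [:free_gen (Xs ! j):] - poly_const (M j)) ` cocircuits scale Xs"

lemma eval_family_gens:
  "(\<lambda>p. poly p (free_const t)) ` family_gens M = ideal_gens (\<lambda>j. poly (M j) t)"
  unfolding family_gens_def ideal_gens_def image_Un image_image
  by (simp add: poly_prod poly_poly_const)

lemma eval_family:
  assumes "p \<in> idl.span (family_gens M)"
  shows "poly p (free_const t) \<in> idl.span (ideal_gens (\<lambda>j. poly (M j) t))"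
proof (rule idl_span_hom[OF _ _ _ _ assms])
  fix g assume "g \<in> family_gens M"
  then show "poly g (free_const t) \<in> idl.span (ideal_gens (\<lambda>j. poly (M j) t))"
    unfolding eval_family_gens[symmetric] by (intro idl.span_base imageI)
qed simp_all

lemma lift_family:
  assumes "f \<in> idl.span (ideal_gens (\<lambda>j. poly (M j) t))"
  obtains p where "p \<in> idl.span (family_gens M)" "poly p (free_const t) = f"
proof -
  have "surj (\<lambda>p. poly p (free_const t))" by (rule surjI[of _ "\<lambda>f. [:f:]"]) simp
  then have "\<exists>p\<in>idl.span (family_gens M). poly p (free_const t) = f"
    using assms eval_family_gens[of t M]
    by (intro idl_span_lift[where H = "ideal_gens (\<lambda>j. poly (M j) t)"]) simp_all
  then show thesis using that by blast
qed

text \<open>Equating \<open>Xs ! j\<close> with \<open>M j\<close> for all \<open>j\<close> in a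
  basis makes every vector congruent to a polynomial in t, hence also every element. This is the
  hypothesis of \<open>spanning\<close>, with coefficients from C[t].\<close>

lemma basis_quotient:
  fixes M :: "nat \<Rightarrow> complex poly" and f :: "'v free_alg poly"
  assumes "B \<in> bases"
  shows "\<exists>c\<in>range poly_const. f - c \<in> idl.span ((\<lambda>r. [:r:]) ` linear_relations scale \<union>
    (\<lambda>j. [:free_gen (Xs ! j):] - poly_const (M j)) ` B)" (is "\<exists>c\<in>_. _ \<in> idl.span ?G")
proof -
  have rel: "[:free_gen (v + w):] - [:free_gen v:] - [:free_gen w:] \<in> idl.span ?G"
    "[:free_gen (scale c v):] - [:free_const c * free_gen v:] \<in> idl.span ?G" for v w c
    by (intro idl.span_base; force simp: linear_relations_def)+
  have gen: "\<exists>p. [:free_gen v:] - poly_const p \<in> idl.span ?G" for v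
  proof -
    have "v \<in> span ((!) Xs ` B)" using assms by (simp add: bases_def)
    then show ?thesis
    proof (induction rule: span_induct_alt)
      case base
      have "[:free_gen 0:] \<in> idl.span ?G" using idl.span_neg[OF rel(1)[of 0 0]] by simp
      then show ?case by (intro exI[of _ 0]) (simp add: poly_const_hom)
    next
      case (step c x y)
      then obtain j p where j: "j \<in> B" "x = Xs ! j" and p: "[:free_gen y:] - poly_const p \<in> idl.span ?G"
        by blast
      have x: "[:free_gen x:] - poly_const (M j) \<in> idl.span ?G" using j by (auto intro: idl.span_base)
      have "[:free_gen (scale c x + y):] - poly_const (smult c (M j) + p) =
        ([:free_gen (scale c x + y):] - [:free_gen (scale c x):] - [:free_gen y:]) +
        (([:free_gen (scale c x):] - [:free_const c * free_gen x:]) +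
        ([:free_const c:] * ([:free_gen x:] - poly_const (M j)) + ([:free_gen y:] - poly_const p)))"
        by (simp add: poly_const_hom smult_diff_right)
      also have "\<dots> \<in> idl.span ?G"
        by (intro idl.span_add idl.span_scale rel x p)
      finally show ?case by blast
    qed
  qed
  have "\<exists>p. f - poly_const p \<in> idl.span ?G"
  proof (induction f rule: free_poly_induct)
    case (add f g)
    then obtain p q where "f - poly_const p \<in> idl.span ?G" "g - poly_const q \<in> idl.span ?G" by blast
    from idl.span_add[OF this] show ?case
      by (intro exI[of _ "p + q"]) (simp add: poly_const_hom algebra_simps)
  next
    case (const_mult c f)
    then obtain p where "f - poly_const p \<in> idl.span ?G" by blast
    from idl.span_scale[OF this, of "[:free_const c:]"] show ?case
      by (intro exI[of _ "smult c p"]) (simp add: poly_const_hom smult_diff_right)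
  next
    case (t_mult f)
    then obtain p where "f - poly_const p \<in> idl.span ?G" by blast
    from idl.span_scale[OF this, of "[:0, 1:]"] show ?case
      by (intro exI[of _ "pCons 0 p"]) (simp add: poly_const_hom free_const_hom)
  next
    case one
    show ?case by (intro exI[of _ 1]) (simp add: poly_const_hom idl.span_zero)
  next
    case (gen_mult v f)
    then obtain p where p: "f - poly_const p \<in> idl.span ?G" by blast
    obtain q where q: "[:free_gen v:] - poly_const q \<in> idl.span ?G" using gen by blast
    have mult: "poly_const (q * p) = poly_const q * poly_const p"
      by (induction q) (simp_all add: poly_const_hom free_const_hom)
    have "[:free_gen v:] * f - poly_const (q * p)
      = [:free_gen v:] * (f - poly_const p) + poly_const p * ([:free_gen v:] - poly_const q)"
      unfolding mult by (simp only: algebra_simps)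
    also have "\<dots> \<in> idl.span ?G" by (intro idl.span_add idl.span_scale p q)
    finally show ?case by blast
  qed
  then show ?thesis by blast
qed

text \<open>Serves two choices of \<open>M\<close>: constant shifts give spanning for fixed shifts,
  while deformed shifts allow the error term of a lifted relation to be expanded.\<close>

lemma family_spanning:
  fixes M :: "nat \<Rightarrow> complex poly" and f :: "'v free_alg poly"
  obtains e where "f - (\<Sum>B\<in>bases. poly_const (e B) *
      (\<Prod>j\<in>ext_passive B. [:free_gen (Xs ! j):] - poly_const (M j))) \<in> idl.span (family_gens M)"
proof -
  obtain c where c: "c ` bases \<subseteq> range poly_const"
    "f - (\<Sum>B\<in>bases. c B * (\<Prod>j\<in>ext_passive B. [:free_gen (Xs ! j):] - poly_const (M j)))
      \<in> idl.span (family_gens M)"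
    using spanning[OF basis_quotient[where M = M], of f] unfolding family_gens_def by blast
  from c(1) have "\<forall>B\<in>bases. \<exists>e. c B = poly_const e" by blast
  from bchoice[OF this] obtain e where "\<forall>B\<in>bases. c B = poly_const (e B)" ..
  then show thesis using c(2) that[of e] by simp
qed

text \<open>The point of the dual space at which \<open>Xs ! i\<close> takes the value \<open>m i\<close> for all \<open>i\<close> in the basis \<open>B\<close>.\<close>

definition vertex :: "(nat \<Rightarrow> complex) \<Rightarrow> nat set \<Rightarrow> 'v \<Rightarrow> complex"
  where "vertex m B v = (\<Sum>i\<in>B. representation ((!) Xs ` B) v (Xs ! i) * m i)"

lemma vertex_linear:
  assumes "B \<in> bases"
  shows "vertex m B (v + w) = vertex m B v + vertex m B w" "vertex m B (scale c v) = c * vertex m B v"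
  using assms unfolding bases_def indep_def vertex_def
  by (simp_all add: representation_add representation_scale sum.distrib distrib_right
      sum_distrib_left mult.assoc)

lemma vertex_nth:
  assumes "B \<in> bases" "j \<in> B"
  shows "vertex m B (Xs ! j) = m j"
proof -
  \<comment> \<open>Injectivity on \<open>B\<close> turns equality of vectors into equality of
    indices.\<close>
  have "representation ((!) Xs ` B) (Xs ! j) (Xs ! i) = (if i = j then 1 else 0)" if "i \<in> B" for i
    using assms that representation_basis[of "(!) Xs ` B" "Xs ! j"]
    unfolding bases_def indep_def by (auto dest: inj_onD)
  moreover have "finite B" using assms(1) finite_subset by (auto simp: bases_def indep_def)
  moreover from calculation have "vertex m B (Xs ! j) = (\<Sum>i\<in>B. if i = j then m i else 0)"
    unfolding vertex_def by (intro sum.cong) auto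
  ultimately show ?thesis using assms(2) by simp
qed

text \<open>A cocircuit meets every basis, since a basis in its complement would make the complement
  span. So each product has a factor vanishing at the vertex; the linear relations vanish because
  \<open>vertex\<close> is linear.\<close>

lemma vertex_vanishes:
  assumes "B \<in> bases" "f \<in> idl.span (ideal_gens m)"
  shows "eval_free (vertex m B) f = 0"
  using assms(2)
proof (induction rule: idl.span_induct_alt)
  case (step r x y)
  have "eval_free (vertex m B) x = 0"
  proof (cases "x \<in> linear_relations scale")
    case True
    then show ?thesis
      by (auto simp: linear_relations_def eval_free_diff eval_free_mult vertex_linear[OF assms(1)])
  next
    case False
    then obtain Y where Y: "Y \<in> cocircuits scale Xs"
      "x = (\<Prod>j\<in>Y. free_gen (Xs ! j) - free_const (m j))"
      using step(1) by (auto simp: ideal_gens_def)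
    have "Y \<inter> B \<noteq> {}"
    proof
      assume "Y \<inter> B = {}"
      then have "(!) Xs ` B \<subseteq> (!) Xs ` ({..<length Xs} - Y)"
        using assms(1) by (auto simp: bases_def indep_def)
      from span_mono[OF this] show False using Y(1) assms(1) by (auto simp: cocircuits_eq bases_def)
    qed
    then obtain j where "j \<in> Y" "j \<in> B" by blast
    moreover have "finite Y" using Y(1) finite_subset by (auto simp: cocircuits_eq)
    ultimately show ?thesis
      unfolding Y(2) eval_free_prod
      by (intro prod_zero bexI[of _ j]) (auto simp: eval_free_diff vertex_nth[OF assms(1)])
  qed
  then show ?case using step by (simp add: eval_free_add eval_free_mult)
qed simp

text \<open>At the first difference \<open>j\<close> of the two bases, \<open>Xs ! j\<close> is
  independent of their common initial part, so \<open>j\<close> is passive for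
  \<open>A\<close>.\<close>

lemma ext_passive_lex_less:
  assumes "B \<in> bases" "A \<in> bases" "lex_less A B"
  shows "ext_passive A \<inter> B \<noteq> {}"
proof -
  obtain j where j: "j \<in> B - A" "A \<inter> {..<j} = B \<inter> {..<j}" using assms(3) by (auto simp: lex_less_def)
  have "indep (insert j (B \<inter> {..<j}))" using assms(1) j(1) by (auto simp: bases_def intro: indep_mono)
  then have "Xs ! j \<notin> span ((!) Xs ` (B \<inter> {..<j}))" by (simp add: indep_insert)
  moreover have "j < length Xs" using assms(1) j(1) by (auto simp: bases_def indep_def)
  ultimately show ?thesis using j by (auto simp: ext_passive_def)
qed

text \<open>Evaluation at the vertices is triangular with respect to the lexicographic order of bases.\<close>

lemma generic_independent:
  assumes gen: "\<And>B j. B \<in> bases \<Longrightarrow> j \<in> {..<length Xs} - B \<Longrightarrow> vertex m B (Xs ! j) \<noteq> m j"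
    and mem: "(\<Sum>B\<in>bases. free_const (c B) * (\<Prod>j\<in>ext_passive B. free_gen (Xs ! j) - free_const (m j)))
      \<in> idl.span (ideal_gens m)"
    and "B \<in> bases"
  shows "c B = 0"
proof (rule ccontr)
  let ?p = "\<lambda>A B. \<Prod>j\<in>ext_passive A. vertex m B (Xs ! j) - m j"
  let ?S = "{B \<in> bases. c B \<noteq> 0}"
  assume "c B \<noteq> 0"
  then have "finite ?S" "?S \<noteq> {}"
    using assms(3) finite_bases by auto
  moreover have "asymp_on ?S lex_less" "transp_on ?S lex_less"
    using lex_less_asym lex_less_trans by (blast intro: asymp_onI transp_onI)+
  ultimately obtain D where D: "D \<in> ?S" "\<forall>A\<in>?S. A \<noteq> D \<longrightarrow> \<not> lex_less D A"
    using Finite_Set.bex_max_element[of ?S lex_less] by blast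
  have fin: "finite (ext_passive A)" for A by (simp add: ext_passive_def)
  have zero: "c A * ?p A D = 0" if A: "A \<in> bases" "A \<noteq> D" for A
  proof (cases "c A = 0")
    case False
    then have "\<not> lex_less D A" using A False D(2) by simp
    then have "lex_less A D" using lex_less_total[OF A(2)] by simp
    then obtain j where "j \<in> ext_passive A" "j \<in> D"
      using ext_passive_lex_less[of D A] A(1) D(1) by auto
    then have "?p A D = 0" using D(1) fin by (intro prod_zero bexI[of _ j]) (simp_all add: vertex_nth)
    then show ?thesis by simp
  qed simp
  have "0 = (\<Sum>A\<in>bases. c A * ?p A D)"
    using vertex_vanishes[OF _ mem, of D] D(1)
    by (simp add: eval_free_sum eval_free_mult eval_free_prod eval_free_diff)
  also have "\<dots> = c D * ?p D D"
  proof -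
    have "(\<Sum>A\<in>bases - {D}. c A * ?p A D) = 0" by (rule sum.neutral) (use zero in blast)
    then show ?thesis using D(1) by (simp add: sum.remove[OF finite_bases, of D])
  qed
  \<comment> \<open>The passive indices of \<open>D\<close> lie outside \<open>D\<close>, and by
    genericity their hyperplanes miss the vertex of \<open>D\<close>.\<close>
  also have "\<dots> \<noteq> 0" using D(1) fin gen[of D] by (auto simp: ext_passive_def)
  finally show False by simp
qed

text \<open>The exponent \<open>j + 1\<close> makes the shifts linearly independent modulo constants, so that no vertex
  lies identically on a further hyperplane; it is positive so that the deformation is trivial at \<open>t = 0\<close>.\<close>

definition deformation :: "(nat \<Rightarrow> complex) \<Rightarrow> nat \<Rightarrow> complex poly"
  where "deformation m j = [:m j:] + monom 1 (Suc j)"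

lemma poly_deformation_0: "poly (deformation m j) 0 = m j"
  by (simp add: deformation_def poly_monom)

lemma deformation_generic:
  "finite {t. \<exists>B\<in>bases. \<exists>j\<in>{..<length Xs} - B.
    vertex (\<lambda>i. poly (deformation m i) t) B (Xs ! j) = poly (deformation m j) t}"
proof -
  have "finite {t. vertex (\<lambda>i. poly (deformation m i) t) B (Xs ! j) = poly (deformation m j) t}"
    if "B \<in> bases" "j \<in> {..<length Xs} - B" for B j
  proof -
    \<comment> \<open>The roots of \<open>q\<close> are the parameters at which the vertex of
      \<open>B\<close> lies on hyperplane \<open>j\<close>. The power t^(j+1) comes only from the
      shift of \<open>j\<close>, as \<open>j\<close> is not in \<open>B\<close>.\<close>
    define q where "q = (\<Sum>i\<in>B. smult (representation ((!) Xs ` B) (Xs ! j) (Xs ! i)) (deformation m i))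
      - deformation m j"
    have "coeff q (Suc j) = - 1"
      using that unfolding q_def deformation_def
      by (auto simp: coeff_sum coeff_pCons intro!: sum.neutral)
    then have "q \<noteq> 0" by auto
    then have "finite {t. poly q t = 0}" by (rule poly_roots_finite)
    then show ?thesis by (simp add: q_def vertex_def poly_sum)
  qed
  then have "finite (\<Union>B\<in>bases. \<Union>j\<in>{..<length Xs} - B.
    {t. vertex (\<lambda>i. poly (deformation m i) t) B (Xs ! j) = poly (deformation m j) t})"
    using finite_bases by blast
  then show ?thesis by (rule finite_subset[rotated]) blast
qed

text \<open>Generic independence passes to t = 0 because spanning holds over all of C[t]: no
  relation can appear in the special fibre alone.\<close>

lemma independent_mod_ideal:
  assumes mem: "(\<Sum>B\<in>bases. free_const (c B) * (\<Prod>j\<in>ext_passive B. free_gen (Xs ! j) - free_const (m j)))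
      \<in> idl.span (ideal_gens m)"
    and "B \<in> bases"
  shows "c B = 0"
proof -
  define M where "M = deformation m"
  let ?q = "\<lambda>B. \<Prod>j\<in>ext_passive B. [:free_gen (Xs ! j):] - poly_const (M j)"
  let ?J = "idl.span (family_gens M)"
  have m: "m = (\<lambda>j. poly (M j) 0)" by (simp add: M_def poly_deformation_0)
  have ev: "poly (poly_const p) (free_const t) = free_const (poly p t)" for p t by (rule poly_poly_const)
  have ev0: "poly p 0 = poly p (free_const 0)" for p :: "'v free_alg poly" by (simp add: free_const_hom)
  \<comment> \<open>The relation lifts to the deformation up to a multiple of \<open>t\<close>; expanding the quotient by \<open>t\<close>
    in the spanning set perturbs the coefficients by multiples of \<open>t\<close> only.\<close>
  obtain g where g: "g \<in> ?J" "poly g (free_const 0) =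
      (\<Sum>B\<in>bases. free_const (c B) * (\<Prod>j\<in>ext_passive B. free_gen (Xs ! j) - free_const (m j)))"
    using lift_family[of _ M 0] mem unfolding m by blast
  define h where "h = (\<Sum>B\<in>bases. [:free_const (c B):] * ?q B) - g"
  have "poly h 0 = 0"
    unfolding ev0 h_def using g(2) by (simp add: poly_sum poly_prod ev m)
  then obtain h' where h': "h = pCons 0 h'"
    by (metis pCons_cases poly_0_coeff_0 coeff_pCons_0)
  obtain e where e: "h' - (\<Sum>B\<in>bases. poly_const (e B) * ?q B) \<in> ?J" by (rule family_spanning)
  have coef: "poly_const ([:c B:] - pCons 0 (e B)) = [:free_const (c B):] - [:0, 1:] * poly_const (e B)" for B
  proof -
    have "poly_const ([:c B:] - pCons 0 (e B)) = pCons (free_const (c B)) (poly_const (- e B))"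
      by (simp add: poly_const_hom)
    then show ?thesis by (simp add: poly_const_hom)
  qed
  \<comment> \<open>The corrected coefficients c_B - t e_B(t) satisfy an exact relation in the
    family.\<close>
  have "(\<Sum>B\<in>bases. poly_const ([:c B:] - pCons 0 (e B)) * ?q B) =
      g + [:0, 1:] * (h' - (\<Sum>B\<in>bases. poly_const (e B) * ?q B))"
  proof -
    have "(\<Sum>B\<in>bases. poly_const ([:c B:] - pCons 0 (e B)) * ?q B) =
      (h + g) - [:0, 1:] * (\<Sum>B\<in>bases. poly_const (e B) * ?q B)"
      unfolding coef h_def left_diff_distrib sum_subtractf sum_distrib_left by (simp add: mult.assoc)
    then show ?thesis unfolding h' right_diff_distrib by simp
  qed
  also have "\<dots> \<in> ?J" using g(1) e by (intro idl.span_add idl.span_scale)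
  finally have fam: "(\<Sum>B\<in>bases. poly_const ([:c B:] - pCons 0 (e B)) * ?q B) \<in> ?J" .
  have "poly ([:c B:] - pCons 0 (e B)) t = 0"
    if t: "t \<notin> {t. \<exists>B\<in>bases. \<exists>j\<in>{..<length Xs} - B.
      vertex (\<lambda>i. poly (M i) t) B (Xs ! j) = poly (M j) t}" for t
  proof (rule generic_independent[where c = "\<lambda>B. poly ([:c B:] - pCons 0 (e B)) t", OF _ _ assms(2)])
    show "(\<Sum>B\<in>bases. free_const (poly ([:c B:] - pCons 0 (e B)) t) *
      (\<Prod>j\<in>ext_passive B. free_gen (Xs ! j) - free_const (poly (M j) t)))
      \<in> idl.span (ideal_gens (\<lambda>j. poly (M j) t))"
      using eval_family[OF fam, of t] unfolding poly_sum poly_mult poly_prod ev poly_diff by simp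
  qed (use t in blast)
  \<comment> \<open>Vanishing outside a finite set of parameters gives infinitely many roots, so the
    polynomial is zero; its constant coefficient is \<open>c B\<close>.\<close>
  then have "- {t. poly ([:c B:] - pCons 0 (e B)) t = 0} \<subseteq> {t. \<exists>B\<in>bases. \<exists>j\<in>{..<length Xs} - B.
      vertex (\<lambda>i. poly (M i) t) B (Xs ! j) = poly (M j) t}" by blast
  then have "finite (- {t. poly ([:c B:] - pCons 0 (e B)) t = 0})"
    unfolding M_def using deformation_generic finite_subset by blast
  then have "infinite {t. poly ([:c B:] - pCons 0 (e B)) t = 0}"
    using infinite_UNIV_char_0 finite_compl by blast
  then have "[:c B:] - pCons 0 (e B) = 0" using poly_roots_finite by blast
  then show ?thesis by simp
qed

lemma spans_mod_ideal:
  fixes f :: "'v free_alg"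
  obtains c where "f - (\<Sum>B\<in>bases. free_const (c B) *
      (\<Prod>j\<in>ext_passive B. free_gen (Xs ! j) - free_const (m j))) \<in> idl.span (ideal_gens m)"
proof -
  \<comment> \<open>Shifts constant in t turn spanning over C[t], read at t = 0, into spanning for
    the fixed shifts.\<close>
  define M where "M j = [:m j:]" for j
  obtain e where "[:f:] - (\<Sum>B\<in>bases. poly_const (e B) *
      (\<Prod>j\<in>ext_passive B. [:free_gen (Xs ! j):] - poly_const (M j))) \<in> idl.span (family_gens M)"
    by (rule family_spanning)
  from eval_family[OF this, of 0]
  have "f - (\<Sum>B\<in>bases. free_const (poly (e B) 0) *
      (\<Prod>j\<in>ext_passive B. free_gen (Xs ! j) - free_const (poly (M j) 0)))
      \<in> idl.span (ideal_gens (\<lambda>j. poly (M j) 0))"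
    by (simp add: poly_sum poly_prod poly_poly_const)
  then show thesis using that by (simp add: M_def)
qed

end

section \<open>Transfer to the quotient ring\<close>

lemma type_ring_simps [simp]:
  "carrier ring_of_type_algebra = UNIV" "\<one>\<^bsub>ring_of_type_algebra\<^esub> = 1" "\<zero>\<^bsub>ring_of_type_algebra\<^esub> = 0"
  "x \<otimes>\<^bsub>ring_of_type_algebra\<^esub> y = x * y" "x \<oplus>\<^bsub>ring_of_type_algebra\<^esub> y = x + y"
  by (simp_all add: ring_of_type_algebra_def)

lemma type_ring_minus: "x \<ominus>\<^bsub>ring_of_type_algebra\<^esub> y = x - (y :: 'r::comm_ring_1)"
proof -
  interpret R: ring "ring_of_type_algebra :: 'r ring" by (rule ring_from_type_algebra)
  have "\<ominus>\<^bsub>ring_of_type_algebra\<^esub> y = - y" by (rule R.minus_equality) simp_all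
  then show ?thesis by (simp add: a_minus_def)
qed

lemma type_ring_finprod: "finprod ring_of_type_algebra f S = (prod f S :: 'r::comm_ring_1)"
proof -
  interpret R: cring "ring_of_type_algebra :: 'r ring" by (rule cring_from_type_algebra)
  show ?thesis by (induction S rule: infinite_finite_induct) auto
qed

lemma ideal_idl_span: "ideal (idl.span G) (ring_of_type_algebra :: 'r::comm_ring_1 ring)"
proof (rule idealI)
  interpret R: ring "ring_of_type_algebra :: 'r ring" by (rule ring_from_type_algebra)
  show "ring (ring_of_type_algebra :: 'r ring)" by (rule ring_from_type_algebra)
  show "subgroup (idl.span G) (add_monoid (ring_of_type_algebra :: 'r ring))"
  proof (rule R.add.subgroupI)
    show "\<ominus>\<^bsub>ring_of_type_algebra\<^esub> a \<in> idl.span G" if "a \<in> idl.span G" for a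
      using idl.span_neg[OF that] type_ring_minus[of 0 a] by (simp add: a_minus_def)
  qed (use idl.span_zero[of G] idl.span_add in auto)
qed (use idl.span_scale in \<open>auto simp: mult.commute\<close>)

definition sym_proj :: "(complex \<Rightarrow> 'v \<Rightarrow> 'v) \<Rightarrow> ('v::ab_group_add) free_alg \<Rightarrow> 'v free_alg set"
  where "sym_proj scale f = linear_ideal scale +>\<^bsub>free_ring\<^esub> f"

text \<open>\<open>A_X\<close> is a quotient of a quotient; this composite projection allows
  computing with representatives in the free algebra.\<close>

definition A_X_proj :: "(complex \<Rightarrow> 'v \<Rightarrow> 'v) \<Rightarrow> ('v::ab_group_add) list \<Rightarrow> complex list
    \<Rightarrow> 'v free_alg \<Rightarrow> 'v free_alg set set"
  where "A_X_proj scale Xs mu f = I_X scale Xs mu +>\<^bsub>sym_alg scale\<^esub> sym_proj scale f"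

lemma sym_proj_hom: "ring_hom_cring free_ring (sym_alg scale) (sym_proj scale)"
  unfolding sym_alg_def sym_proj_def[abs_def]
  by (rule ideal.rcos_ring_hom_cring[OF linear_ideal_ideal cring_from_type_algebra])

lemma A_X_proj_hom: "ring_hom_cring free_ring (A_X scale Xs mu) (A_X_proj scale Xs mu)"
proof -
  interpret h: ring_hom_cring free_ring "sym_alg scale" "sym_proj scale" by (rule sym_proj_hom)
  interpret g: ring_hom_cring "sym_alg scale" "A_X scale Xs mu" "(+>\<^bsub>sym_alg scale\<^esub>) (I_X scale Xs mu)"
    unfolding A_X_def by (rule ideal.rcos_ring_hom_cring[OF I_X_ideal cring_sym_alg])
  have "(+>\<^bsub>sym_alg scale\<^esub>) (I_X scale Xs mu) \<circ> sym_proj scale \<in> ring_hom free_ring (A_X scale Xs mu)"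
    by (rule ring_hom_trans[OF h.homh g.homh])
  then show ?thesis
    by (intro ring_hom_cringI) (simp_all add: cring_from_type_algebra cring_A_X A_X_proj_def[abs_def] comp_def)
qed

lemma sym_proj_surj: "sym_proj scale ` UNIV = carrier (sym_alg scale)"
  by (auto simp: sym_proj_def sym_alg_def FactRing_def A_RCOSETS_def')

lemma A_X_proj_surj: "A_X_proj scale Xs mu ` UNIV = carrier (A_X scale Xs mu)"
proof -
  have "carrier (A_X scale Xs mu) = (+>\<^bsub>sym_alg scale\<^esub>) (I_X scale Xs mu) ` carrier (sym_alg scale)"
    by (auto simp: A_X_def FactRing_def A_RCOSETS_def')
  then show ?thesis
    unfolding sym_proj_surj[symmetric] by (simp add: image_image A_X_proj_def)
qed

lemma A_X_scalars_eq: "A_X_scalars scale Xs mu = range (\<lambda>c. A_X_proj scale Xs mu (free_const c))"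
  by (simp add: A_X_scalars_def A_X_proj_def sym_proj_def sym_const_def)

text \<open>The projection commutes with differences and finite products, so the generators have
  explicit representatives in the free algebra.\<close>

lemma I_X_eq:
  "I_X scale Xs mu = Idl\<^bsub>sym_alg scale\<^esub> (sym_proj scale `
    prod (\<lambda>j. free_gen (Xs ! j) - free_const (mu ! j)) ` cocircuits scale Xs)"
proof -
  interpret h: ring_hom_cring free_ring "sym_alg scale" "sym_proj scale" by (rule sym_proj_hom)
  have diff: "sym_vec scale v \<ominus>\<^bsub>sym_alg scale\<^esub> sym_const scale c = sym_proj scale (free_gen v - free_const c)" for v c
    unfolding type_ring_minus[symmetric] a_minus_def
    by (subst h.hom_add) (simp_all add: sym_vec_def sym_const_def sym_proj_def[symmetric])
  have "(\<Otimes>\<^bsub>sym_alg scale\<^esub>j\<in>Y. sym_vec scale (Xs ! j) \<ominus>\<^bsub>sym_alg scale\<^esub> sym_const scale (mu ! j)) =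
    sym_proj scale (\<Prod>j\<in>Y. free_gen (Xs ! j) - free_const (mu ! j))" for Y
    unfolding type_ring_finprod[symmetric] diff by (subst h.hom_finprod) (simp_all add: comp_def)
  then show ?thesis unfolding I_X_def by (intro arg_cong[where f = "genideal (sym_alg scale)"]) auto
qed

section \<open>Kernel of the projection, scalars and linear combinations in the quotient\<close>

context vector_list
begin

text \<open>The two stages kill first the linear relations and then the products, so the kernel is
  the ideal generated by both.\<close>

lemma A_X_proj_eq_zero_iff:
  "A_X_proj scale Xs mu f = \<zero>\<^bsub>A_X scale Xs mu\<^esub> \<longleftrightarrow> f \<in> idl.span (ideal_gens ((!) mu))"
proof -
  interpret F: cring "free_ring :: 'v free_alg ring" by (rule cring_from_type_algebra)
  interpret S: cring "sym_alg scale" by (rule cring_sym_alg)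
  interpret h: ring_hom_cring free_ring "sym_alg scale" "sym_proj scale" by (rule sym_proj_hom)
  interpret p: ring_hom_cring free_ring "A_X scale Xs mu" "A_X_proj scale Xs mu" by (rule A_X_proj_hom)
  let ?J = "idl.span (ideal_gens ((!) mu))"
  let ?G = "prod (\<lambda>j. free_gen (Xs ! j) - free_const (mu ! j)) ` cocircuits scale Xs"
  have J: "ideal ?J free_ring" by (rule ideal_idl_span)
  have G: "ideal_gens ((!) mu) = linear_relations scale \<union> ?G" by (simp add: ideal_gens_def)
  have zero: "\<zero>\<^bsub>A_X scale Xs mu\<^esub> = I_X scale Xs mu" by (simp add: A_X_def FactRing_def)
  show ?thesis
  proof
    assume "A_X_proj scale Xs mu f = \<zero>\<^bsub>A_X scale Xs mu\<^esub>"
    then have "sym_proj scale f \<in> I_X scale Xs mu"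
      unfolding zero A_X_proj_def by (rule ideal.rcos_const_imp_mem[OF I_X_ideal h.hom_closed, rotated]) simp
    \<comment> \<open>The projection maps an ideal onto an ideal, and this image contains the
      generators of \<open>I_X\<close>.\<close>
    also have "I_X scale Xs mu \<subseteq> sym_proj scale ` ?J"
      unfolding I_X_eq
    proof (rule S.genideal_minimal)
      show "ideal (sym_proj scale ` ?J) (sym_alg scale)"
        using F.ring_ideal_imp_quot_ideal[OF linear_ideal_ideal J]
        unfolding sym_alg_def sym_proj_def[abs_def] .
      show "sym_proj scale ` ?G \<subseteq> sym_proj scale ` ?J" unfolding G by (auto intro: idl.span_base)
    qed
    finally obtain g where g: "g \<in> ?J" "sym_proj scale f = sym_proj scale g" by blast
    have "f - g \<in> linear_ideal scale"
      using g(2) F.quotient_eq_iff_same_a_r_cos[OF linear_ideal_ideal, of f g]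
      by (simp add: sym_proj_def type_ring_minus)
    also have "linear_ideal scale \<subseteq> ?J"
      unfolding linear_ideal_def by (rule F.genideal_minimal[OF J]) (auto simp: G intro: idl.span_base)
    finally show "f \<in> ?J" using idl.span_add[OF _ g(1), of "f - g"] by simp
  next
    assume "f \<in> ?J"
    then show "A_X_proj scale Xs mu f = \<zero>\<^bsub>A_X scale Xs mu\<^esub>"
    proof (induction rule: idl.span_induct_alt)
      case base
      show ?case using p.hom_zero by simp
    next
      case (step r x y)
      have "A_X_proj scale Xs mu x = \<zero>\<^bsub>A_X scale Xs mu\<^esub>"
      proof (cases "x \<in> linear_relations scale")
        case True
        then have "x \<in> linear_ideal scale"
          unfolding linear_ideal_def using F.genideal_self[of "linear_relations scale"] by auto
        then have "sym_proj scale x = sym_proj scale 0"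
          using F.quotient_eq_iff_same_a_r_cos[OF linear_ideal_ideal, of x 0]
          by (simp add: sym_proj_def type_ring_minus)
        then show ?thesis using p.hom_zero by (simp add: A_X_proj_def)
      next
        case False
        then have "sym_proj scale x \<in> I_X scale Xs mu"
          using step(1) S.genideal_self[of "sym_proj scale ` ?G"] sym_proj_surj[of scale]
          unfolding G I_X_eq by auto
        then show ?thesis unfolding zero A_X_proj_def by (rule S.a_rcos_zero[OF I_X_ideal])
      qed
      then show ?case
        using p.hom_add[of "r * x" y] p.hom_mult[of r x] step.IH by simp
    qed
  qed
qed

lemma bases_nonempty:
  assumes "span (set Xs) = UNIV"
  shows "bases \<noteq> {}"
proof -
  obtain S where S: "S \<subseteq> set Xs" "independent S" "set Xs \<subseteq> span S"
    using maximal_independent_subset[of "set Xs"] by blast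
  have "span S = UNIV" using span_minimal[OF S(3)] assms by auto
  moreover have set_eq: "set Xs = (!) Xs ` {..<length Xs}" by (auto simp: set_conv_nth)
  \<comment> \<open>One index is picked for each vector of \<open>S\<close>, which takes care of
    repetitions in the list.\<close>
  moreover obtain B where "B \<subseteq> {..<length Xs}" "inj_on ((!) Xs) B" "S = (!) Xs ` B"
    using S(1) set_eq by (auto simp: subset_image_inj)
  ultimately show ?thesis using S(2) by (auto simp: bases_def indep_def)
qed

text \<open>\<open>combine\<close> pairs lists of possibly different lengths and ignores the
  surplus, so scalars and coefficients are compared only on the common part. Distinctness lets
  coefficients be indexed by bases instead of positions.\<close>

lemma combine_eq:
  assumes "distinct Bs" "set Ks \<subseteq> A_X_scalars scale Xs mu"
  shows "\<exists>c. ring.combine (A_X scale Xs mu) Ks (map (\<lambda>B. A_X_proj scale Xs mu (p B)) Bs) =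
      A_X_proj scale Xs mu (\<Sum>B\<in>set Bs. free_const (c B) * p B) \<and>
    take (length Bs) Ks = take (length Ks) (map (\<lambda>B. A_X_proj scale Xs mu (free_const (c B))) Bs)"
  using assms
proof (induction Bs arbitrary: Ks)
  interpret A: cring "A_X scale Xs mu" by (rule cring_A_X)
  interpret p: ring_hom_cring free_ring "A_X scale Xs mu" "A_X_proj scale Xs mu" by (rule A_X_proj_hom)
  {
    case Nil
    show ?case using p.hom_zero by (cases Ks) simp_all
  next
    case (Cons B Bs)
    show ?case
    proof (cases Ks)
      case Nil
      \<comment> \<open>If the scalars run out early, the remaining coefficients are zero.\<close>
      then show ?thesis using p.hom_zero by (intro exI[of _ "\<lambda>_. 0"]) (simp add: free_const_hom)
    next
      case (Cons k Ks')
      then obtain a where a: "k = A_X_proj scale Xs mu (free_const a)"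
        using Cons.prems by (auto simp: A_X_scalars_eq)
      obtain c where c: "A.combine Ks' (map (\<lambda>B. A_X_proj scale Xs mu (p B)) Bs) =
          A_X_proj scale Xs mu (\<Sum>B\<in>set Bs. free_const (c B) * p B)"
        "take (length Bs) Ks' = take (length Ks') (map (\<lambda>B. A_X_proj scale Xs mu (free_const (c B))) Bs)"
        using Cons.IH[of Ks'] Cons.prems Cons by auto
      define c' where "c' = c(B := a)"
      have c': "c' B = a" "\<And>D. D \<in> set Bs \<Longrightarrow> c' D = c D" using Cons.prems(1) by (auto simp: c'_def)
      have sum_eq: "(\<Sum>D\<in>set (B # Bs). free_const (c' D) * p D) =
          free_const a * p B + (\<Sum>D\<in>set Bs. free_const (c D) * p D)"
        using Cons.prems(1) c' by simp
      have map_eq: "map (\<lambda>B. A_X_proj scale Xs mu (free_const (c' B))) (B # Bs) =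
          k # map (\<lambda>B. A_X_proj scale Xs mu (free_const (c B))) Bs"
        using c' a by simp
      have proj_eq: "A_X_proj scale Xs mu (free_const a * p B + (\<Sum>D\<in>set Bs. free_const (c D) * p D)) =
          A_X_proj scale Xs mu (free_const a) \<otimes>\<^bsub>A_X scale Xs mu\<^esub> A_X_proj scale Xs mu (p B) \<oplus>\<^bsub>A_X scale Xs mu\<^esub>
          A_X_proj scale Xs mu (\<Sum>D\<in>set Bs. free_const (c D) * p D)"
        using p.hom_add p.hom_mult by simp
      show ?thesis
      proof (intro exI conjI)
        show "A.combine Ks (map (\<lambda>B. A_X_proj scale Xs mu (p B)) (B # Bs)) =
            A_X_proj scale Xs mu (\<Sum>D\<in>set (B # Bs). free_const (c' D) * p D)"
          by (simp only: Cons sum_eq proj_eq A.combine.simps list.map a c(1))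
        show "take (length (B # Bs)) Ks =
            take (length Ks) (map (\<lambda>B. A_X_proj scale Xs mu (free_const (c' B))) (B # Bs))"
          unfolding map_eq Cons using c(2) by simp
      qed
    qed
  }
qed

lemma combine_map:
  assumes "distinct Bs"
  shows "ring.combine (A_X scale Xs mu) (map (\<lambda>B. A_X_proj scale Xs mu (free_const (c B))) Bs)
      (map (\<lambda>B. A_X_proj scale Xs mu (p B)) Bs) =
    A_X_proj scale Xs mu (\<Sum>B\<in>set Bs. free_const (c B) * p B)"
  using assms
proof (induction Bs)
  interpret A: cring "A_X scale Xs mu" by (rule cring_A_X)
  interpret p: ring_hom_cring free_ring "A_X scale Xs mu" "A_X_proj scale Xs mu" by (rule A_X_proj_hom)
  {
    case Nil
    show ?case using p.hom_zero by simp
  next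
    case (Cons B Bs)
    then show ?case
      using p.hom_add[of "free_const (c B) * p B"] p.hom_mult[of "free_const (c B)" "p B"] by simp
  }
qed

text \<open>The image of the field of complex numbers is a subfield once 1 and 0 differ. They do, as
  evaluation at a vertex kills the ideal but not 1; a vertex exists because \<open>Xs\<close>
  spans.\<close>

lemma A_X_scalars_subfield:
  assumes "span (set Xs) = UNIV"
  shows "subfield (A_X_scalars scale Xs mu) (A_X scale Xs mu)"
proof -
  interpret A: cring "A_X scale Xs mu" by (rule cring_A_X)
  interpret p: ring_hom_cring free_ring "A_X scale Xs mu" "A_X_proj scale Xs mu" by (rule A_X_proj_hom)
  interpret C: field "ring_of_type_algebra :: complex ring" by (rule field_from_type_algebra)
  let ?h = "\<lambda>c. A_X_proj scale Xs mu (free_const c)"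
  obtain B where "B \<in> bases" using bases_nonempty[OF assms] by blast
  then have "1 \<notin> idl.span (ideal_gens ((!) mu))"
    using vertex_vanishes[of B 1] eval_free_const[of "vertex ((!) mu) B" 1] by (auto simp: free_const_hom)
  then have one: "\<one>\<^bsub>A_X scale Xs mu\<^esub> \<noteq> \<zero>\<^bsub>A_X scale Xs mu\<^esub>"
    using p.hom_one by (simp add: A_X_proj_eq_zero_iff[symmetric])
  interpret h: ring_hom_ring "ring_of_type_algebra :: complex ring" "A_X scale Xs mu" ?h
  proof (intro ring_hom_ringI2 ring_hom_memI)
    show "?h (x \<otimes>\<^bsub>ring_of_type_algebra\<^esub> y) = ?h x \<otimes>\<^bsub>A_X scale Xs mu\<^esub> ?h y" for x y
      using p.hom_mult[of "free_const x" "free_const y"] by (simp add: free_const_hom)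
    show "?h (x \<oplus>\<^bsub>ring_of_type_algebra\<^esub> y) = ?h x \<oplus>\<^bsub>A_X scale Xs mu\<^esub> ?h y" for x y
      using p.hom_add[of "free_const x" "free_const y"] by (simp add: free_const_hom)
    show "?h \<one>\<^bsub>ring_of_type_algebra\<^esub> = \<one>\<^bsub>A_X scale Xs mu\<^esub>"
      using p.hom_one by (simp add: free_const_hom)
    show "?h x \<in> carrier (A_X scale Xs mu)" for x using A_X_proj_surj by blast
  qed (rule C.ring_axioms A.ring_axioms)+
  show ?thesis
    using h.img_is_subfield(2)[OF C.carrier_is_subfield one] by (simp add: A_X_scalars_eq)
qed

end

section \<open>The classes of the products over passive indices form a basis\<close>

theorem theorem4p6:
  fixes scale :: "complex \<Rightarrow> 'v::ab_group_add \<Rightarrow> 'v"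
    and Xs :: "'v list" and mu :: "complex list"
  assumes "vector_space scale"
    and "0 \<notin> set Xs"
    and "module.span scale (set Xs) = UNIV"
    and "length mu = length Xs"
  shows "ring.dimension (A_X scale Xs mu) (num_bases scale Xs)
           (A_X_scalars scale Xs mu) (carrier (A_X scale Xs mu))"
proof -
  interpret V: vector_list scale Xs using assms(1) by (simp add: vector_list_def)
  interpret A: cring "A_X scale Xs mu" by (rule cring_A_X)
  interpret p: ring_hom_cring free_ring "A_X scale Xs mu" "A_X_proj scale Xs mu" by (rule A_X_proj_hom)
  let ?K = "A_X_scalars scale Xs mu"
  let ?p = "\<lambda>B. \<Prod>j\<in>V.ext_passive B. free_gen (Xs ! j) - free_const (mu ! j)"
  have K: "subfield ?K (A_X scale Xs mu)" by (rule V.A_X_scalars_subfield[OF assms(3)])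
  obtain Bs where Bs: "set Bs = V.bases" "distinct Bs" using finite_distinct_list[OF V.finite_bases] by blast
  define us where "us = map (\<lambda>B. A_X_proj scale Xs mu (?p B)) Bs"
  have us: "set us \<subseteq> carrier (A_X scale Xs mu)" unfolding us_def using A_X_proj_surj by auto
  have "A.independent ?K us"
  \<comment> \<open>Scalars beyond the length of \<open>us\<close> are ignored by
    \<open>combine\<close>, so only the initial part of \<open>Ks\<close> has to vanish.\<close>
  proof (rule A.trivial_combine_imp_independent[OF K us])
    fix Ks assume Ks: "set Ks \<subseteq> ?K" "A.combine Ks us = \<zero>\<^bsub>A_X scale Xs mu\<^esub>"
    obtain c where c: "A.combine Ks us = A_X_proj scale Xs mu (\<Sum>B\<in>set Bs. free_const (c B) * ?p B)"
      "take (length us) Ks = take (length Ks) (map (\<lambda>B. A_X_proj scale Xs mu (free_const (c B))) Bs)"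
      using V.combine_eq[OF Bs(2) Ks(1), of ?p] unfolding us_def by auto
    have "c B = 0" if "B \<in> V.bases" for B
      using V.independent_mod_ideal[OF _ that] Ks(2) c(1)
      by (simp add: V.A_X_proj_eq_zero_iff Bs(1))
    then have "set (map (\<lambda>B. A_X_proj scale Xs mu (free_const (c B))) Bs) \<subseteq> {\<zero>\<^bsub>A_X scale Xs mu\<^esub>}"
      using Bs(1) p.hom_zero by (auto simp: free_const_hom)
    then show "set (take (length us) Ks) \<subseteq> {\<zero>\<^bsub>A_X scale Xs mu\<^esub>}"
      unfolding c(2) using set_take_subset by fast
  qed
  then have "A.dimension (length us) ?K (A.Span ?K us)" by (rule A.dimension_independent)
  moreover have "length us = num_bases scale Xs"
    unfolding us_def V.num_bases_eq Bs(1)[symmetric] using distinct_card[OF Bs(2)] by simp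
  moreover have "A.Span ?K us = carrier (A_X scale Xs mu)"
  proof
    show "A.Span ?K us \<subseteq> carrier (A_X scale Xs mu)"
      by (rule A.Span_in_carrier[OF subfieldE(3)[OF K] us])
    show "carrier (A_X scale Xs mu) \<subseteq> A.Span ?K us"
    proof
      fix x assume "x \<in> carrier (A_X scale Xs mu)"
      then obtain f where f: "x = A_X_proj scale Xs mu f" using A_X_proj_surj by blast
      obtain c where c: "f - (\<Sum>B\<in>V.bases. free_const (c B) * ?p B) \<in> idl.span (V.ideal_gens ((!) mu))"
        by (rule V.spans_mod_ideal)
      let ?s = "\<Sum>B\<in>V.bases. free_const (c B) * ?p B"
      \<comment> \<open>The difference \<open>f - ?s\<close> lies in the kernel, so \<open>x\<close>
        is the class of the explicit combination \<open>?s\<close>.\<close>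
      have "x = A_X_proj scale Xs mu (f - ?s) \<oplus>\<^bsub>A_X scale Xs mu\<^esub> A_X_proj scale Xs mu ?s"
        unfolding f using p.hom_add[of "f - ?s" ?s] by simp
      also have "\<dots> = A_X_proj scale Xs mu ?s"
        using c p.hom_closed[of ?s] by (simp add: V.A_X_proj_eq_zero_iff[symmetric])
      also have "\<dots> = A.combine (map (\<lambda>B. A_X_proj scale Xs mu (free_const (c B))) Bs) us"
        unfolding us_def using V.combine_map[OF Bs(2)] Bs(1) by simp
      finally show "x \<in> A.Span ?K us"
        unfolding A.Span_eq_combine_set[OF K us] 
        by (auto simp: A_X_scalars_eq intro!: exI[of _ "map (\<lambda>B. A_X_proj scale Xs mu (free_const (c B))) Bs"])
    qed
  qed
  ultimately show ?thesis by simp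
qed

end
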